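(* Let $(N_1,m_1)\vartriangleright_E(N_2,m_2)$ with both marked nets safe, let $G=(V,R,A)$ be a well-formed TFG for this equivalence, and let $\mathcal{C}$ be the concurrency relation of $G$. Let $\|$ be the concurrency relation between roots of $G$ (defined below). Run the following algorithm $\mathrm{Matrix}(G,\|)$, which returns a symmetric matrix $M$ indexed by $V\times V$: Initialize $M[x,y]=0$ for all $x,y\in V$. For every root $v$ with $v\,\|\,v$, call $\mathrm{Propagate}(v)$. Then, for every pair of distinct roots $v,w$ with $v\,\|\,w$, and every $(v',w')\in\mathrm{succ}(v)\times\mathrm{succ}(w)$, set $M[v',w']=M[w',v']=1$. Return $M$. $\mathrm{Propagate}(v)$: for every $w\in\mathrm{succ}(v)$ set $M[v,w]=M[w,v]=1$; for every $w$ with $v\to w$ call $\mathrm{Propagate}(w)$; for every $w$ with $(v,w)\in R$ and every $(v',w')\in(\mathrm{succ}(v)\setminus\mathrm{succ}(w))\times\mathrm{succ}(w)$ set $M[v',w']=M[w',v']=1$. Then the algorithm terminates and, for all nodes $v,w\in V$, $v\,\mathcal{C}\,w$ holds if and only if $M[v,w]=1$.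
   Context: A Petri net $N=(P,T,\mathrm{Pre},\mathrm{Post})$ has a finite set of places $P$, a finite set of transitions $T$, and flow functions $\mathrm{Pre},\mathrm{Post}:T\to(P\to\mathbb{N})$. A marking is $m:P\to\mathbb{N}$; $t$ is enabled at $m$ if $m\ge\mathrm{Pre}(t)$, and firing gives $m-\mathrm{Pre}(t)+\mathrm{Post}(t)$. $R(N,m_0)$ is the set of markings reachable from $m_0$ by finite (possibly empty) firing sequences. $(N,m_0)$ is safe if every reachable marking has at most one token in each place. Places $p,q$ of $(N,m_0)$ are concurrent, $p\,\|_N\,q$, if some $m\in R(N,m_0)$ has $m(p)>0$ and $m(q)>0$; $p$ is nondead if $p\,\|_N\,p$. Linear systems: $E$ is a finite collection of equations $x=y_1+\dots+y_l$, with variable set $\mathrm{fv}(E)$; solutions are non-negative integer; consistent means having a solution. For a partial map $c$ defined exactly on $v_1,\dots,v_k$, $[c]$ is the system $v_1=c(v_1),\dots,v_k=c(v_k)$; commas denote union. $E$-equivalence: $(N_1,m_1)\vartriangleright_E(N_2,m_2)$ (place sets $P_1,P_2$) iff (A1) $E,[m]$ consistent for every $m\in R(N_1,m_1)\cup R(N_2,m_2)$; (A2) $E,[m_1],[m_2]$ consistent; (A3) for all markings $m_1'$ of $N_1$, $m_2'$ of $N_2$ with $E,[m_1'],[m_2']$ consistent, $m_1'\in R(N_1,m_1)\iff m_2'\in R(N_2,m_2)$. TFGs: fix pairwise disjoint sets $K(n)$, $n\in\mathbb{N}$, of constant nodes of value $n$, disjoint from place/variable names; $K=\bigcup_nK(n)$.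 A TFG with places $P$ is $(V,R,A)$, $V=P\cup S$ with $S\subset K$ finite, $R,A\subseteq V\times V$ disjoint; $v\mathbin{\to\!\bullet} w$ iff $(v,w)\in R$, $v\mathbin{\circ\!\to} w$ iff $(v,w)\in A$, $v\to w$ for either. Roots have no incoming arc; $\circ$-leaves have no outgoing $A$-arc. $v\to^\star w$ means there is a path from $v$ to $w$ or $v=w$; $\mathrm{succ}(v)=\{w:v\to^\star w\}$. $v\mathbin{\circ\!\to} X$: $X$ is the nonempty set of all $A$-successors of $v$; $X\mathbin{\to\!\bullet} v$: $X$ is the nonempty set of all $R$-predecessors of $v$. Well-formed TFG for $(N_1,m_1)\vartriangleright_E(N_2,m_2)$: (T1) $V\setminus K=P_1\cup P_2\cup\mathrm{fv}(E)$; (T2) nodes in $V\cap K$ are roots; (T3) not both $p\mathbin{\circ\!\to} q$ and $p'\to q$ with $p\ne p'$, and not both $p\mathbin{\to\!\bullet} q$ and $p\mathbin{\circ\!\to} q$; (T4) $v\mathbin{\circ\!\to} X$ or $X\mathbin{\to\!\bullet} v$ iff the equation $v=\sum_{x\in X}x$ is in $E$; (T5) acyclic; (T6) roots not in $K$ are exactly $P_2$, $\circ$-leaves not in $K$ exactly $P_1$. (Hence the roots of $G$ are the places of $N_2$ and the constant nodes.) A configuration is a partial $c:V\to\mathbb{N}$ ($\bot$ where undefined) with $c(v)=n$ for $v\in V\cap K(n)$; total if defined everywhere; $c_{|N}$ is its restriction to the places of $N$. $c$ is well-defined if (CBot) whenever $v\to w$, $c(v)=\bot\iff c(w)=\bot$;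 (CEq) whenever $c(v)\ne\bot$ and ($v\mathbin{\circ\!\to} X$ or $X\mathbin{\to\!\bullet} v$), $c(v)=\sum_{x\in X}c(x)$. The concurrency relation $\mathcal{C}$ of $G$: $v\,\mathcal{C}\,w$ iff there is a total, well-defined configuration $c$ with $c_{|N_2}\in R(N_2,m_2)$, $c(v)>0$ and $c(w)>0$. Concurrency relation between roots $\|$: for roots $v,w\in P_2$, $v\,\|\,w$ iff $v\,\|_{N_2}\,w$ in $(N_2,m_2)$; if $v\in K(1)$, then $v\,\|\,w$ (and $w\,\|\,v$) holds iff $w$ is nondead (a constant in $K(1)$ or a nondead place of $N_2$); if $v\in K(0)$ then $v$ is related to no root.
   Formalization: Root concurrency is extended so that constants in K(n) with n≥2 count as live like K(1) (otherwise an isolated K(2) node k has k 𝒞 k but M[k,k]=0); T4 is read as describing every equation of E, so equations with repeated summands are excluded. *)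

theory Defs
  imports "HOL-Library.Multiset"
begin

section \<open>Petri nets\<close>

text \<open>
  Place names, variables and constant nodes all live in one type \<open>'v\<close>. Markings and
  configurations are partial maps; a marking of a net is defined exactly on its places.
  The values of \<open>pre\<close> and \<open>post\<close> outside the places and transitions are never used.
\<close>

record ('v, 't) net =
  places :: "'v set"
  transitions :: "'t set"
  pre :: "'t \<Rightarrow> 'v \<Rightarrow> nat"
  post :: "'t \<Rightarrow> 'v \<Rightarrow> nat"

definition petri_net :: "('v, 't) net \<Rightarrow> bool" where
  "petri_net N \<longleftrightarrow> finite (places N) \<and> finite (transitions N)"

definition marking :: "('v, 't) net \<Rightarrow> ('v \<rightharpoonup> nat) \<Rightarrow> bool" where
  "marking N m \<longleftrightarrow> dom m = places N"

definition enabled :: "('v, 't) net \<Rightarrow> ('v \<rightharpoonup> nat) \<Rightarrow> 't \<Rightarrow> bool" where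
  "enabled N m t \<longleftrightarrow> t \<in> transitions N \<and> (\<forall>p\<in>places N. pre N t p \<le> the (m p))"

definition fire :: "('v, 't) net \<Rightarrow> 't \<Rightarrow> ('v \<rightharpoonup> nat) \<Rightarrow> ('v \<rightharpoonup> nat)" where
  "fire N t m =
     (\<lambda>p. if p \<in> places N then Some (the (m p) - pre N t p + post N t p) else None)"

inductive_set reachable :: "('v, 't) net \<Rightarrow> ('v \<rightharpoonup> nat) \<Rightarrow> ('v \<rightharpoonup> nat) set"
  for N m0 where
  refl: "m0 \<in> reachable N m0"
| step: "m \<in> reachable N m0 \<Longrightarrow> enabled N m t \<Longrightarrow> fire N t m \<in> reachable N m0"

definition safe :: "('v, 't) net \<Rightarrow> ('v \<rightharpoonup> nat) \<Rightarrow> bool" where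
  "safe N m0 \<longleftrightarrow> (\<forall>m\<in>reachable N m0. \<forall>p\<in>places N. the (m p) \<le> 1)"

definition concurrent :: "('v, 't) net \<Rightarrow> ('v \<rightharpoonup> nat) \<Rightarrow> 'v \<Rightarrow> 'v \<Rightarrow> bool" where
  "concurrent N m0 p q \<longleftrightarrow>
     p \<in> places N \<and> q \<in> places N \<and> (\<exists>m\<in>reachable N m0. the (m p) > 0 \<and> the (m q) > 0)"

definition nondead :: "('v, 't) net \<Rightarrow> ('v \<rightharpoonup> nat) \<Rightarrow> 'v \<Rightarrow> bool" where
  "nondead N m0 p \<longleftrightarrow> concurrent N m0 p p"


section \<open>Linear systems and E-equivalence\<close>

text \<open>
  \<open>K n\<close> is the set of constant nodes of value \<open>n\<close>. A constant node may occur in an equation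
  wherever a variable may, and every solution must give it its value. An equation
  \<open>x = y\<^sub>1 + \<dots> + y\<^sub>l\<close> is the pair of \<open>x\<close> and the multiset of summands; numerals are
  summands because the systems \<open>[c]\<close> below contain equations \<open>v = n\<close>.
\<close>

definition constant_sets :: "(nat \<Rightarrow> 'v set) \<Rightarrow> bool" where
  "constant_sets K \<longleftrightarrow> (\<forall>i j. i \<noteq> j \<longrightarrow> K i \<inter> K j = {})"

definition constants :: "(nat \<Rightarrow> 'v set) \<Rightarrow> 'v set" where
  "constants K = (\<Union>n. K n)"

datatype 'v summand = Name 'v | Number nat

type_synonym 'v equation = "'v \<times> 'v summand multiset"

primrec summand_value :: "('v \<Rightarrow> nat) \<Rightarrow> 'v summand \<Rightarrow> nat" where
  "summand_value f (Name x) = f x"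
| "summand_value f (Number n) = n"

definition fv :: "(nat \<Rightarrow> 'v set) \<Rightarrow> 'v equation set \<Rightarrow> 'v set" where
  "fv K E = {x. \<exists>(y, Y)\<in>E. x = y \<or> Name x \<in># Y} - constants K"

definition solution :: "(nat \<Rightarrow> 'v set) \<Rightarrow> 'v equation set \<Rightarrow> ('v \<Rightarrow> nat) \<Rightarrow> bool" where
  "solution K E f \<longleftrightarrow>
     (\<forall>n. \<forall>k\<in>K n. f k = n) \<and>
     (\<forall>(x, Y)\<in>E. f x = (\<Sum>y\<in>#Y. summand_value f y))"

definition consistent :: "(nat \<Rightarrow> 'v set) \<Rightarrow> 'v equation set \<Rightarrow> bool" where
  "consistent K E \<longleftrightarrow> (\<exists>f. solution K E f)"

definition map_system :: "('v \<rightharpoonup> nat) \<Rightarrow> 'v equation set" where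
  "map_system c = {(v, {#Number n#}) | v n. c v = Some n}"

definition E_equivalent ::
  "(nat \<Rightarrow> 'v set) \<Rightarrow> 'v equation set \<Rightarrow>
   ('v, 't1) net \<Rightarrow> ('v \<rightharpoonup> nat) \<Rightarrow> ('v, 't2) net \<Rightarrow> ('v \<rightharpoonup> nat) \<Rightarrow> bool" where
  "E_equivalent K E N1 m1 N2 m2 \<longleftrightarrow>
     (\<forall>m \<in> reachable N1 m1 \<union> reachable N2 m2. consistent K (E \<union> map_system m)) \<and>
     consistent K (E \<union> map_system m1 \<union> map_system m2) \<and>
     (\<forall>m1' m2'. marking N1 m1' \<longrightarrow> marking N2 m2' \<longrightarrow>
        consistent K (E \<union> map_system m1' \<union> map_system m2') \<longrightarrow>
        (m1' \<in> reachable N1 m1 \<longleftrightarrow> m2' \<in> reachable N2 m2))"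


section \<open>Token flow graphs\<close>

record 'v tfg =
  nodes :: "'v set"
  Rarcs :: "('v \<times> 'v) set"
  Aarcs :: "('v \<times> 'v) set"

definition arcs :: "'v tfg \<Rightarrow> ('v \<times> 'v) set" where
  "arcs G = Rarcs G \<union> Aarcs G"

definition is_tfg :: "(nat \<Rightarrow> 'v set) \<Rightarrow> 'v set \<Rightarrow> 'v tfg \<Rightarrow> bool" where
  "is_tfg K P G \<longleftrightarrow>
     (\<exists>S. finite S \<and> S \<subseteq> constants K \<and> nodes G = P \<union> S) \<and>
     Rarcs G \<subseteq> nodes G \<times> nodes G \<and> Aarcs G \<subseteq> nodes G \<times> nodes G \<and>
     Rarcs G \<inter> Aarcs G = {}"

definition roots :: "'v tfg \<Rightarrow> 'v set" where
  "roots G = {v \<in> nodes G. \<nexists>u. (u, v) \<in> arcs G}"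

definition Aleaves :: "'v tfg \<Rightarrow> 'v set" where
  "Aleaves G = {v \<in> nodes G. \<nexists>w. (v, w) \<in> Aarcs G}"

definition succ :: "'v tfg \<Rightarrow> 'v \<Rightarrow> 'v set" where
  "succ G v = {w. (v, w) \<in> (arcs G)\<^sup>*}"

definition A_succs :: "'v tfg \<Rightarrow> 'v \<Rightarrow> 'v set \<Rightarrow> bool" where
  "A_succs G v X \<longleftrightarrow> X \<noteq> {} \<and> X = {w. (v, w) \<in> Aarcs G}"

definition R_preds :: "'v tfg \<Rightarrow> 'v set \<Rightarrow> 'v \<Rightarrow> bool" where
  "R_preds G X v \<longleftrightarrow> X \<noteq> {} \<and> X = {u. (u, v) \<in> Rarcs G}"

text \<open>
  The equivalence for \<open>E\<close> ranges over all right-hand sides, so every equation of \<open>E\<close> must come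
  from the graph: an equation with a repeated summand or with a numeral is excluded.
  The second conjunct makes the places of both nets disjoint from the constant nodes.
\<close>

definition well_formed_tfg ::
  "(nat \<Rightarrow> 'v set) \<Rightarrow> 'v equation set \<Rightarrow> ('v, 't1) net \<Rightarrow> ('v, 't2) net \<Rightarrow> 'v tfg \<Rightarrow> bool" where
  "well_formed_tfg K E N1 N2 G \<longleftrightarrow>
     is_tfg K (nodes G - constants K) G \<and>
     nodes G - constants K = places N1 \<union> places N2 \<union> fv K E \<and>
     nodes G \<inter> constants K \<subseteq> roots G \<and>
     ((\<forall>p p' q. (p, q) \<in> Aarcs G \<longrightarrow> (p', q) \<in> arcs G \<longrightarrow> p = p') \<and>
      (\<forall>p q. \<not> ((p, q) \<in> Rarcs G \<and> (p, q) \<in> Aarcs G))) \<and>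
     (\<forall>v Y. (v, Y) \<in> E \<longleftrightarrow>
        (\<exists>X. Y = image_mset Name (mset_set X) \<and> (A_succs G v X \<or> R_preds G X v))) \<and>
     acyclic (arcs G) \<and>
     (roots G - constants K = places N2 \<and> Aleaves G - constants K = places N1)"

definition configuration :: "(nat \<Rightarrow> 'v set) \<Rightarrow> 'v tfg \<Rightarrow> ('v \<rightharpoonup> nat) \<Rightarrow> bool" where
  "configuration K G c \<longleftrightarrow>
     dom c \<subseteq> nodes G \<and> (\<forall>n. \<forall>v \<in> nodes G \<inter> K n. c v = Some n)"

definition total_configuration :: "'v tfg \<Rightarrow> ('v \<rightharpoonup> nat) \<Rightarrow> bool" where
  "total_configuration G c \<longleftrightarrow> dom c = nodes G"

definition well_defined :: "'v tfg \<Rightarrow> ('v \<rightharpoonup> nat) \<Rightarrow> bool" where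
  "well_defined G c \<longleftrightarrow>
     (\<forall>(v, w) \<in> arcs G. c v = None \<longleftrightarrow> c w = None) \<and>
     (\<forall>v X. c v \<noteq> None \<longrightarrow> A_succs G v X \<or> R_preds G X v \<longrightarrow>
        the (c v) = (\<Sum>x\<in>X. the (c x)))"

definition tfg_concurrent ::
  "(nat \<Rightarrow> 'v set) \<Rightarrow> 'v tfg \<Rightarrow> ('v, 't) net \<Rightarrow> ('v \<rightharpoonup> nat) \<Rightarrow> 'v \<Rightarrow> 'v \<Rightarrow> bool" where
  "tfg_concurrent K G N2 m2 v w \<longleftrightarrow> v \<in> nodes G \<and> w \<in> nodes G \<and>
     (\<exists>c. configuration K G c \<and> total_configuration G c \<and> well_defined G c \<and>
        c |` places N2 \<in> reachable N2 m2 \<and> the (c v) > 0 \<and> the (c w) > 0)"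

text \<open>
  A constant root of value at least 2 is treated like one of value 1. When the nets are safe such
  a node can only be isolated, but well-formedness does not exclude it.
\<close>

definition live_root ::
  "(nat \<Rightarrow> 'v set) \<Rightarrow> ('v, 't) net \<Rightarrow> ('v \<rightharpoonup> nat) \<Rightarrow> 'v \<Rightarrow> bool" where
  "live_root K N2 m2 v \<longleftrightarrow> (\<exists>n\<ge>1. v \<in> K n) \<or> nondead N2 m2 v"

definition root_concurrent ::
  "(nat \<Rightarrow> 'v set) \<Rightarrow> 'v tfg \<Rightarrow> ('v, 't) net \<Rightarrow> ('v \<rightharpoonup> nat) \<Rightarrow> 'v \<Rightarrow> 'v \<Rightarrow> bool" where
  "root_concurrent K G N2 m2 v w \<longleftrightarrow> v \<in> roots G \<and> w \<in> roots G \<and>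
     (concurrent N2 m2 v w \<or>
      (\<exists>n\<ge>1. v \<in> K n) \<and> live_root K N2 m2 w \<or>
      (\<exists>n\<ge>1. w \<in> K n) \<and> live_root K N2 m2 v)"


section \<open>The algorithm\<close>

text \<open>
  Small-step semantics: a state is a stack of pending tasks together with the current matrix.
  A loop over a set may visit its elements in any order, so a loop is entered by choosing an
  enumeration of the set. \<open>Mark S\<close> is the loop assigning 1 to \<open>M[x,y]\<close> and \<open>M[y,x]\<close> for all
  \<open>(x, y)\<close> in \<open>S\<close>, and \<open>Mark1 x y\<close> is its body. Unordered pairs of distinct concurrent roots are
  visited in both orientations.
\<close>

datatype 'v task = Matrix | Propagate 'v | Mark "('v \<times> 'v) set" | Mark1 'v 'v

type_synonym 'v state = "'v task list \<times> ('v \<Rightarrow> 'v \<Rightarrow> nat)"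

definition enumerates :: "'a list \<Rightarrow> 'a set \<Rightarrow> bool" where
  "enumerates xs S \<longleftrightarrow> distinct xs \<and> set xs = S"

definition mark_sym :: "'v \<Rightarrow> 'v \<Rightarrow> ('v \<Rightarrow> 'v \<Rightarrow> nat) \<Rightarrow> ('v \<Rightarrow> 'v \<Rightarrow> nat)" where
  "mark_sym x y M = (\<lambda>a b. if (a, b) = (x, y) \<or> (a, b) = (y, x) then 1 else M a b)"

inductive alg_step :: "'v tfg \<Rightarrow> ('v \<Rightarrow> 'v \<Rightarrow> bool) \<Rightarrow> 'v state \<Rightarrow> 'v state \<Rightarrow> bool"
  for G par where
  matrix:
    "enumerates vs {v \<in> roots G. par v v} \<Longrightarrow>
     enumerates ps {(v, w). v \<in> roots G \<and> w \<in> roots G \<and> v \<noteq> w \<and> par v w} \<Longrightarrow>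
     alg_step G par (Matrix # ts, M)
       (map Propagate vs @ map (\<lambda>(v, w). Mark (succ G v \<times> succ G w)) ps @ ts, \<lambda>x y. 0)"
| propagate:
    "enumerates ws {w. (v, w) \<in> arcs G} \<Longrightarrow>
     enumerates rs {w. (v, w) \<in> Rarcs G} \<Longrightarrow>
     alg_step G par (Propagate v # ts, M)
       (Mark ({v} \<times> succ G v) # map Propagate ws @
        map (\<lambda>w. Mark ((succ G v - succ G w) \<times> succ G w)) rs @ ts, M)"
| mark:
    "enumerates ps S \<Longrightarrow>
     alg_step G par (Mark S # ts, M) (map (\<lambda>(x, y). Mark1 x y) ps @ ts, M)"
| mark1:
    "alg_step G par (Mark1 x y # ts, M) (ts, mark_sym x y M)"

text \<open>
  Termination means that, whatever orders are chosen, there is no infinite run and no run gets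
  stuck with tasks still pending. The initial matrix \<open>M0\<close> is the uninitialized memory.
\<close>

definition alg_terminates ::
  "'v tfg \<Rightarrow> ('v \<Rightarrow> 'v \<Rightarrow> bool) \<Rightarrow> ('v \<Rightarrow> 'v \<Rightarrow> nat) \<Rightarrow> bool" where
  "alg_terminates G par M0 \<longleftrightarrow>
     (\<nexists>s. s 0 = ([Matrix], M0) \<and> (\<forall>i. alg_step G par (s i) (s (Suc i)))) \<and>
     (\<forall>ts M. (alg_step G par)\<^sup>*\<^sup>* ([Matrix], M0) (ts, M) \<longrightarrow>
        (\<nexists>s'. alg_step G par (ts, M) s') \<longrightarrow> ts = [])"

definition alg_returns ::
  "'v tfg \<Rightarrow> ('v \<Rightarrow> 'v \<Rightarrow> bool) \<Rightarrow> ('v \<Rightarrow> 'v \<Rightarrow> nat) \<Rightarrow> ('v \<Rightarrow> 'v \<Rightarrow> nat) \<Rightarrow> bool" where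
  "alg_returns G par M0 M \<longleftrightarrow> (alg_step G par)\<^sup>*\<^sup>* ([Matrix], M0) ([], M)"

end

theory Submission
  imports Defs
begin

text \<open>
  Total well-defined configurations are flows on an acyclic graph, and a token can be moved
  from a node along any path below it without disturbing the rest of the graph. By
  E-equivalence every flow over a reachable marking of \<open>N\<^sub>2\<close> restricts to a reachable marking of
  \<open>N\<^sub>1\<close>, so safety bounds flows by 1 off the roots: no node receives two tokens at once. Hence tokens
  at incomparable nodes can be moved independently, which makes every marked pair concurrent.
  Conversely, if \<open>v\<close> and \<open>w\<close> both carry a token, trace the tokens upwards. Either they come from
  two distinct roots, or one of the nodes lies below the other, or the traces separate at a
  lowest common marked ancestor. As that ancestor holds a single token, it cannot split it among two
  \<open>A\<close>-successors, so one of the two branches leaves by an \<open>R\<close>-arc, as in the last loop of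
  \<open>Propagate\<close>.
\<close>

section \<open>Successor sets, and flows as total functions\<close>

lemma succ_refl [simp]: "v \<in> succ G v"
  by (simp add: succ_def)

lemma succ_trans: "w \<in> succ G v \<Longrightarrow> x \<in> succ G w \<Longrightarrow> x \<in> succ G v"
  by (auto simp: succ_def)

lemma arc_succ: "(v, w) \<in> arcs G \<Longrightarrow> w \<in> succ G v"
  by (auto simp: succ_def)

lemma succ_last: "w \<in> succ G v \<Longrightarrow> w \<noteq> v \<Longrightarrow> \<exists>u \<in> succ G v. (u, w) \<in> arcs G"
  unfolding succ_def by (auto elim: rtranclE)

lemma succ_root: "w \<in> roots G \<Longrightarrow> w \<in> succ G v \<Longrightarrow> w = v"
  using succ_last[of w G v] by (auto simp: roots_def)

text \<open>A total configuration satisfies (CBot) trivially, so only (CEq) is kept. Values off the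
  nodes are unconstrained when all arcs stay inside the graph.\<close>

definition flow :: "'v tfg \<Rightarrow> ('v \<Rightarrow> nat) \<Rightarrow> bool" where
  "flow G f \<longleftrightarrow> (\<forall>v X. A_succs G v X \<or> R_preds G X v \<longrightarrow> f v = (\<Sum>x\<in>X. f x))"

lemma flow_A:
  assumes "flow G f" "(v, x) \<in> Aarcs G"
  shows "f v = (\<Sum>w | (v, w) \<in> Aarcs G. f w)"
proof -
  have "A_succs G v {w. (v, w) \<in> Aarcs G}" using assms(2) by (auto simp: A_succs_def)
  then show ?thesis using assms(1) by (simp add: flow_def)
qed

lemma flow_R:
  assumes "flow G f" "(x, v) \<in> Rarcs G"
  shows "f v = (\<Sum>u | (u, v) \<in> Rarcs G. f u)"
proof -
  have "R_preds G {u. (u, v) \<in> Rarcs G} v" using assms(2) by (auto simp: R_preds_def)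
  then show ?thesis using assms(1) by (simp add: flow_def)
qed

lemma flowI:
  assumes A: "\<And>v x. (v, x) \<in> Aarcs G \<Longrightarrow> f v = (\<Sum>w | (v, w) \<in> Aarcs G. f w)"
    and R: "\<And>v x. (x, v) \<in> Rarcs G \<Longrightarrow> f v = (\<Sum>u | (u, v) \<in> Rarcs G. f u)"
  shows "flow G f"
  unfolding flow_def
proof (intro allI impI)
  fix v X
  assume "A_succs G v X \<or> R_preds G X v"
  then show "f v = sum f X"
  proof
    assume X: "A_succs G v X"
    then obtain x where "(v, x) \<in> Aarcs G" by (auto simp: A_succs_def)
    from A[OF this] X show ?thesis by (simp add: A_succs_def)
  next
    assume X: "R_preds G X v"
    then obtain x where "(x, v) \<in> Rarcs G" by (auto simp: R_preds_def)
    from R[OF this] X show ?thesis by (simp add: R_preds_def)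
  qed
qed


section \<open>Moving tokens\<close>

text \<open>The graph side of well-formedness: finiteness, (T3) and (T5), without nets or
  equations.\<close>

locale flow_dag =
  fixes G :: "'v tfg"
  assumes finite_nodes: "finite (nodes G)"
    and arcs_nodes: "arcs G \<subseteq> nodes G \<times> nodes G"
    and A_pred_unique: "(p, q) \<in> Aarcs G \<Longrightarrow> (p', q) \<in> arcs G \<Longrightarrow> p = p'"
    and R_A_disjoint: "Rarcs G \<inter> Aarcs G = {}"
    and acyclic_arcs: "acyclic (arcs G)"
begin

lemma finite_arcs: "finite (arcs G)"
  using finite_subset[OF arcs_nodes] finite_nodes by blast

lemma wf_arcs: "wf (arcs G)"
  using finite_acyclic_wf[OF finite_arcs acyclic_arcs] .

lemma wf_arcs_converse: "wf ((arcs G)\<inverse>)"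
  using finite_acyclic_wf_converse[OF finite_arcs acyclic_arcs] .

lemma finite_Asuccs: "finite {w. (v, w) \<in> Aarcs G}"
  by (rule finite_subset[OF _ finite_nodes]) (use arcs_nodes in \<open>auto simp: arcs_def\<close>)

lemma finite_Rpreds: "finite {u. (u, v) \<in> Rarcs G}"
  by (rule finite_subset[OF _ finite_nodes]) (use arcs_nodes in \<open>auto simp: arcs_def\<close>)

lemma succ_subset: "succ G v \<subseteq> insert v (nodes G)"
proof
  fix w assume "w \<in> succ G v"
  then show "w \<in> insert v (nodes G)" using succ_last[of w G v] arcs_nodes by (cases "w = v") auto
qed

lemma finite_succ: "finite (succ G v)"
  using finite_subset[OF succ_subset] finite_nodes by blast

lemma arc_not_succ: "(v, w) \<in> arcs G \<Longrightarrow> v \<notin> succ G w"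
  using acyclic_arcs rtrancl_into_trancl2[of v w "arcs G" v] unfolding succ_def acyclic_def by blast

lemma succ_antisym: "w \<in> succ G v \<Longrightarrow> v \<in> succ G w \<Longrightarrow> v = w"
  using succ_last[of w G v] succ_trans[of v G w] arc_not_succ[of _ w] by blast

text \<open>By uniqueness the \<open>A\<close>-arc would start at \<open>u\<close> too, against
  disjointness. So a node has either a single incoming \<open>A\<close>-arc or only incoming
  \<open>R\<close>-arcs.\<close>

lemma R_not_A: "(u, x) \<in> Rarcs G \<Longrightarrow> (t, x) \<notin> Aarcs G"
  using A_pred_unique[of t x u] R_A_disjoint unfolding arcs_def by blast

lemma flow_R_le: "flow G f \<Longrightarrow> (u, x) \<in> Rarcs G \<Longrightarrow> f u \<le> f x"
  using flow_R[of G f u x] member_le_sum[of u "{u. (u, x) \<in> Rarcs G}" f] finite_Rpreds[of x]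
  by simp

lemma flow_A_le: "flow G f \<Longrightarrow> (u, x) \<in> Aarcs G \<Longrightarrow> f x \<le> f u"
  using flow_A[of G f u x] member_le_sum[of x "{x. (u, x) \<in> Aarcs G}" f] finite_Asuccs[of u]
  by simp

lemma flow_positive_pred:
  assumes "flow G f" "f v > 0" "(u, v) \<in> arcs G"
  obtains t where "(t, v) \<in> arcs G" "f t > 0"
proof (cases "(u, v) \<in> Aarcs G")
  case True
  then show ?thesis using flow_A_le[OF assms(1) True] assms that by force
next
  case False
  then have "(u, v) \<in> Rarcs G" using assms(3) by (auto simp: arcs_def)
  from flow_R[OF assms(1) this] assms(2) obtain t where "(t, v) \<in> Rarcs G" "f t > 0"
    by (metis (mono_tags, lifting) bot_nat_0.not_eq_extremum mem_Collect_eq sum.neutral)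
  then show ?thesis using that by (auto simp: arcs_def)
qed

lemma flow_positive_root:
  assumes "flow G f" "f v > 0" "v \<in> nodes G"
  shows "\<exists>r \<in> roots G. f r > 0 \<and> v \<in> succ G r"
  using assms(2,3)
proof (induction v rule: wf_induct_rule[OF wf_arcs])
  case (1 v)
  show ?case
  proof (cases "v \<in> roots G")
    case True
    then show ?thesis using 1 by auto
  next
    case False
    then obtain u where "(u, v) \<in> arcs G" using 1 by (auto simp: roots_def)
    then obtain t where t: "(t, v) \<in> arcs G" "f t > 0"
      using flow_positive_pred[OF assms(1)] 1 by blast
    moreover have "t \<in> nodes G" using t arcs_nodes by auto
    ultimately show ?thesis using 1(1)[of t] arc_succ[of t v] succ_trans[of t G _ v] by blast
  qed
qed

text \<open>
  Every token of a successor of \<open>u\<close> follows the \<open>A\<close>-arc chosen by \<open>s\<close>. Since the set of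
  successors of \<open>u\<close> is closed under arcs, the flow elsewhere need not change.
\<close>

lemma redistribute:
  assumes f: "flow G f" and s: "\<forall>a b. (a, b) \<in> Aarcs G \<longrightarrow> (a, s a) \<in> Aarcs G"
  shows "\<exists>g. flow G g \<and> (\<forall>y. y \<notin> succ G u - {u} \<longrightarrow> g y = f y) \<and>
    (\<forall>a b. (a, b) \<in> Aarcs G \<longrightarrow> a \<in> succ G u \<longrightarrow> g b = (if s a = b then g a else 0))"
proof -
  define F where "F = (\<lambda>g x. if x \<notin> succ G u - {u} then f x
    else if \<exists>a. (a, x) \<in> Aarcs G \<and> s a = x then g (SOME a. (a, x) \<in> Aarcs G)
    else (\<Sum>a | (a, x) \<in> Rarcs G. g a :: nat))"
  define g where "g = wfrec (arcs G) F"
  have g: "g x = F (cut g (arcs G) x) x" for x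
    unfolding g_def by (rule wfrec[OF wf_arcs])
  have outside: "g y = f y" if "y \<notin> succ G u - {u}" for y
    using that by (subst g) (simp add: F_def)
  have inside: "b \<in> succ G u - {u}" if "(a, b) \<in> arcs G" "a \<in> succ G u" for a b
    using that(2) arc_not_succ[OF that(1)] succ_trans[OF that(2) arc_succ[OF that(1)]] by auto
  have A: "g b = (if s a = b then g a else 0)" if ab: "(a, b) \<in> Aarcs G" and a: "a \<in> succ G u" for a b
  proof -
    have arc: "(a, b) \<in> arcs G" using ab by (auto simp: arcs_def)
    have unique: "(c, b) \<in> Aarcs G \<longleftrightarrow> c = a" for c
      using ab A_pred_unique[OF _ arc] by blast
    have "{c. (c, b) \<in> Rarcs G} = {}" using ab R_not_A by blast
    then show ?thesis using inside[OF arc a] arc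
      by (subst g) (simp add: F_def unique cut_def)
  qed
  have R: "g b = (\<Sum>c | (c, b) \<in> Rarcs G. g c)" if ab: "(a, b) \<in> Rarcs G" for a b
  proof (cases "b \<in> succ G u - {u}")
    case True
    have "\<nexists>c. (c, b) \<in> Aarcs G" using ab R_not_A by blast
    then have "g b = (\<Sum>c | (c, b) \<in> Rarcs G. cut g (arcs G) b c)"
      using True by (subst g) (simp add: F_def)
    also have "\<dots> = (\<Sum>c | (c, b) \<in> Rarcs G. g c)"
      by (rule sum.cong) (auto simp: cut_def arcs_def)
    finally show ?thesis .
  next
    case False
    \<comment> \<open>A predecessor of \<open>b\<close> in \<open>succ G u\<close> would put
      \<open>b\<close> strictly below \<open>u\<close>.\<close>
    have "g c = f c" if "(c, b) \<in> Rarcs G" for c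
      using False inside[of c b] that by (intro outside) (auto simp: arcs_def)
    then show ?thesis using outside[OF False] flow_R[OF f ab] by simp
  qed
  have "flow G g"
  proof (rule flowI)
    fix v x assume vx: "(v, x) \<in> Aarcs G"
    show "g v = (\<Sum>w | (v, w) \<in> Aarcs G. g w)"
    proof (cases "v \<in> succ G u")
      case True
      have "(\<Sum>w | (v, w) \<in> Aarcs G. g w) = (\<Sum>w | (v, w) \<in> Aarcs G. if w = s v then g v else 0)"
        using A[OF _ True] by (intro sum.cong) auto
      also have "\<dots> = g v" using s vx finite_Asuccs by auto
      finally show ?thesis by simp
    next
      case False
      \<comment> \<open>Strictly below \<open>u\<close>, \<open>w\<close> would have a predecessor
        in \<open>succ G u\<close>, but \<open>v\<close> is its only predecessor.\<close>
      have "g w = f w" if vw: "(v, w) \<in> Aarcs G" for w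
      proof (intro outside notI)
        assume "w \<in> succ G u - {u}"
        then obtain t where "t \<in> succ G u" "(t, w) \<in> arcs G" using succ_last[of w G u] by blast
        then show False using A_pred_unique[OF vw] False by blast
      qed
      then show ?thesis using flow_A[OF f vx] outside[of v] False by simp
    qed
  qed (rule R)
  then show ?thesis using outside A by (intro exI[of _ g]) simp
qed

lemma push_arc:
  assumes f: "flow G f" and ux: "(u, x) \<in> arcs G"
  obtains g where "flow G g" "\<And>y. y \<notin> succ G u - {u} \<Longrightarrow> g y = f y" "f u \<le> g x"
proof -
  \<comment> \<open>Tokens of \<open>u\<close> are sent to \<open>x\<close> when the arc is an
    \<open>A\<close>-arc. For an \<open>R\<close>-arc any choice works, as \<open>x\<close> sums
    over predecessors including \<open>u\<close>.\<close>
  define s where "s a = (if a = u \<and> (u, x) \<in> Aarcs G then x else SOME b. (a, b) \<in> Aarcs G)" for a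
  have s: "\<forall>a b. (a, b) \<in> Aarcs G \<longrightarrow> (a, s a) \<in> Aarcs G"
    by (auto simp: s_def intro: someI)
  from redistribute[OF f s] obtain g where
    g: "flow G g" "\<forall>y. y \<notin> succ G u - {u} \<longrightarrow> g y = f y"
      "\<forall>a b. (a, b) \<in> Aarcs G \<longrightarrow> a \<in> succ G u \<longrightarrow> g b = (if s a = b then g a else 0)"
    by blast
  have "g u = f u" using g(2) by blast
  moreover have "g u \<le> g x"
  proof (cases "(u, x) \<in> Aarcs G")
    case True
    then show ?thesis using g(3) True by (simp add: s_def)
  next
    case False
    then show ?thesis using ux flow_R_le[OF g(1)] by (auto simp: arcs_def)
  qed
  ultimately show ?thesis by (intro that[OF g(1)]) (use g(2) in auto)
qed

text \<open>The path is followed arc by arc. Each further push alters only strict successors of the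
  current node \<open>y\<close>; these lie below \<open>u\<close>, and by antisymmetry
  \<open>u\<close> is not among them.\<close>

lemma push:
  assumes f: "flow G f" and "x \<in> succ G u"
  obtains g where "flow G g" "\<And>y. y \<notin> succ G u - {u} \<Longrightarrow> g y = f y" "f u \<le> g x"
proof -
  have "(u, x) \<in> (arcs G)\<^sup>*" using assms(2) by (simp add: succ_def)
  then have "\<exists>g. flow G g \<and> (\<forall>y. y \<notin> succ G u - {u} \<longrightarrow> g y = f y) \<and> f u \<le> g x"
  proof (induction rule: rtrancl_induct)
    case base
    then show ?case using f by blast
  next
    case (step y z)
    have y: "y \<in> succ G u" using step(1) by (simp add: succ_def)
    from step obtain g where g: "flow G g" "\<forall>y. y \<notin> succ G u - {u} \<longrightarrow> g y = f y" "f u \<le> g y"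
      by blast
    from push_arc[OF g(1) step(2)] obtain h where
      h: "flow G h" "\<And>x. x \<notin> succ G y - {y} \<Longrightarrow> h x = g x" "g y \<le> h z" by blast
    have "x \<notin> succ G u - {u} \<Longrightarrow> x \<notin> succ G y - {y}" for x
      using succ_trans[OF y] succ_antisym y by blast
    then have "\<forall>x. x \<notin> succ G u - {u} \<longrightarrow> h x = f x" using h(2) g(2) by simp
    then show ?case using h g(3) order_trans by blast
  qed
  then obtain g where "flow G g" "\<And>y. y \<notin> succ G u - {u} \<Longrightarrow> g y = f y" "f u \<le> g x"
    by blast
  then show ?thesis by (rule that)
qed

end


section \<open>Safe flows\<close>

text \<open>
  \<open>ok\<close> stands for the flows whose restriction to \<open>N\<^sub>2\<close> is reachable; it depends only on the
  values at the roots. Safety of \<open>N\<^sub>1\<close> bounds them at the \<open>A\<close>-leaves that are not constants.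
\<close>

locale safe_flow_dag = flow_dag G for G :: "'v tfg" +
  fixes ok :: "('v \<Rightarrow> nat) \<Rightarrow> bool"
  assumes ok_flow: "ok f \<Longrightarrow> flow G f"
    and ok_roots: "ok f \<Longrightarrow> flow G g \<Longrightarrow> (\<And>r. r \<in> roots G \<Longrightarrow> g r = f r) \<Longrightarrow> ok g"
    and ok_Aleaf: "ok f \<Longrightarrow> v \<in> Aleaves G \<Longrightarrow> v \<notin> roots G \<Longrightarrow> f v \<le> 1"
begin

lemma ok_push:
  assumes f: "ok f" and "x \<in> succ G u"
  obtains g where "ok g" "\<And>y. y \<notin> succ G u - {u} \<Longrightarrow> g y = f y" "f u \<le> g x"
proof -
  from push[OF ok_flow[OF f] assms(2)] obtain g where
    g: "flow G g" "\<And>y. y \<notin> succ G u - {u} \<Longrightarrow> g y = f y" "f u \<le> g x" by blast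
  have "g r = f r" if "r \<in> roots G" for r using g(2) succ_root[OF that] by blast
  then have "ok g" using ok_roots[OF f g(1)] by blast
  then show ?thesis using g(2,3) by (rule that)
qed

text \<open>Downward induction: a token on \<open>v\<close> can be pushed to a successor, where the
  bound holds already, until an \<open>A\<close>-leaf is met. The incoming arc excludes roots, since
  an isolated constant may have a larger value.\<close>

lemma ok_le_1:
  assumes "ok f" "(u, v) \<in> arcs G"
  shows "f v \<le> 1"
  using assms
proof (induction v arbitrary: f u rule: wf_induct_rule[OF wf_arcs_converse])
  case (1 v)
  have nr: "v \<notin> roots G" "v \<in> nodes G" using 1(3) arcs_nodes by (auto simp: roots_def)
  show ?case
  proof (cases "v \<in> Aleaves G")
    case True
    then show ?thesis using ok_Aleaf 1(2) nr by blast
  next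
    case False
    then obtain w where w: "(v, w) \<in> arcs G" using nr by (auto simp: Aleaves_def arcs_def)
    from ok_push[OF 1(2) arc_succ[OF w]] obtain g where "ok g" "f v \<le> g w" by blast
    then show ?thesis using 1(1)[of w g v] w by force
  qed
qed

lemma ok_source_le_1:
  assumes "ok f" "(u, v) \<in> arcs G"
  shows "f u \<le> 1"
proof -
  from ok_push[OF assms(1) arc_succ[OF assms(2)]] obtain g where "ok g" "f u \<le> g v" by blast
  then show ?thesis using ok_le_1[OF _ assms(2)] order_trans by blast
qed

text \<open>Arcs into \<open>z\<close> from distinct sources can only be \<open>R\<close>-arcs, so
  two marked predecessors would put at least two tokens on \<open>z\<close>.\<close>

lemma ok_positive_pred_unique:
  assumes f: "ok f" and "(t, z) \<in> arcs G" "(t', z) \<in> arcs G" "f t > 0" "f t' > 0"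
  shows "t = t'"
proof (rule ccontr)
  assume ne: "t \<noteq> t'"
  then have R: "(t, z) \<in> Rarcs G" "(t', z) \<in> Rarcs G"
    using A_pred_unique[OF _ assms(3)] A_pred_unique[OF _ assms(2)] assms(2,3)
    unfolding arcs_def by blast+
  have "f t + f t' = (\<Sum>u\<in>{t, t'}. f u)" using ne by simp
  also have "\<dots> \<le> (\<Sum>u | (u, z) \<in> Rarcs G. f u)"
    using R finite_Rpreds by (intro sum_mono2) auto
  also have "\<dots> = f z" using flow_R[OF ok_flow[OF f] R(1)] by simp
  finally show False using ok_le_1[OF f assms(2)] assms(4,5) by simp
qed

text \<open>Dually, two marked \<open>A\<close>-successors would need two tokens on
  \<open>u\<close>.\<close>

lemma ok_positive_A_succ_unique:
  assumes f: "ok f" and "(u, x) \<in> Aarcs G" "(u, y) \<in> Aarcs G" "f x > 0" "f y > 0"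
  shows "x = y"
proof (rule ccontr)
  assume ne: "x \<noteq> y"
  have "f x + f y = (\<Sum>u\<in>{x, y}. f u)" using ne by simp
  also have "\<dots> \<le> (\<Sum>w | (u, w) \<in> Aarcs G. f w)"
    using assms finite_Asuccs by (intro sum_mono2) auto
  also have "\<dots> = f u" using flow_A[OF ok_flow[OF f] assms(2)] by simp
  finally show False using ok_source_le_1[OF f, of u x] assms by (simp add: arcs_def)
qed

text \<open>At a first common successor \<open>z\<close>, pushing both tokens to predecessors of
  \<open>z\<close> would bring two tokens to \<open>z\<close>.\<close>

lemma positive_incomparable_disjoint:
  assumes f: "ok f" and "f v > 0" "f w > 0" and vw: "v \<notin> succ G w" "w \<notin> succ G v"
  shows "succ G v \<inter> succ G w = {}"
proof (rule ccontr)
  assume "succ G v \<inter> succ G w \<noteq> {}"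
  then obtain z where z: "z \<in> succ G v \<inter> succ G w"
      "\<And>y. (y, z) \<in> arcs G \<Longrightarrow> y \<notin> succ G v \<inter> succ G w"
    using wfE_min[OF wf_arcs] by (metis ex_in_conv)
  \<comment> \<open>\<open>z\<close> is neither \<open>v\<close> nor \<open>w\<close>, as these are
    incomparable, so each side reaches \<open>z\<close> through a predecessor.\<close>
  obtain t where t: "t \<in> succ G v" "(t, z) \<in> arcs G" using succ_last[of z G v] z vw by blast
  obtain t' where t': "t' \<in> succ G w" "(t', z) \<in> arcs G" using succ_last[of z G w] z vw by blast
  have n: "t \<notin> succ G w" using z t by blast
  from ok_push[OF f t(1)] obtain g where
    g: "ok g" "\<And>y. y \<notin> succ G v - {v} \<Longrightarrow> g y = f y" "f v \<le> g t" by blast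
  from ok_push[OF g(1) t'(1)] obtain h where
    h: "ok h" "\<And>y. y \<notin> succ G w - {w} \<Longrightarrow> h y = g y" "g w \<le> h t'" by blast
  \<comment> \<open>The pushes do not interfere: \<open>w\<close> is not below \<open>v\<close>, and
    by minimality of \<open>z\<close>, \<open>t\<close> is not below \<open>w\<close>.\<close>
  have "h t = g t" "g w = f w" using h(2) g(2) n vw by blast+
  then have "h t > 0" "h t' > 0" using h(3) g(3) assms(2,3) by linarith+
  then have "t = t'" using ok_positive_pred_unique[OF h(1) t(2) t'(2)] by blast
  then show False using n t' by blast
qed

text \<open>
  The marked descendant \<open>z\<close> of \<open>x\<close> nearest to \<open>x\<close> receives its token from \<open>x\<close>: otherwise the
  token of \<open>x\<close> could be moved to \<open>z\<close> too.
\<close>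

lemma positive_step:
  assumes f: "ok f" and "f x > 0" "f w > 0" and w: "w \<in> succ G x" "w \<noteq> x"
  obtains y where "(x, y) \<in> arcs G" "f y > 0" "w \<in> succ G y"
proof -
  define S where "S = {z \<in> succ G x - {x}. f z > 0 \<and> w \<in> succ G z}"
  have "w \<in> S" using assms by (simp add: S_def)
  then obtain z where z: "z \<in> S" "\<And>y. (y, z) \<in> arcs G \<Longrightarrow> y \<notin> S"
    using wfE_min[OF wf_arcs] by metis
  obtain t' where t': "t' \<in> succ G x" "(t', z) \<in> arcs G"
    using succ_last[of z G x] z by (auto simp: S_def)
  have "f z > 0" using z by (simp add: S_def)
  from flow_positive_pred[OF ok_flow[OF f] this t'(2)]
  obtain t where t: "(t, z) \<in> arcs G" "f t > 0" by blast
  have "t = x"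
  proof (rule ccontr)
    assume tx: "t \<noteq> x"
    \<comment> \<open>Inside \<open>succ G x\<close>, \<open>t\<close> would belong to
      \<open>S\<close>, against the choice of \<open>z\<close>. So pushing the token of
      \<open>x\<close> to \<open>t'\<close> leaves \<open>t\<close> marked, and two tokens would
      enter \<open>z\<close>.\<close>
    then have n: "t \<notin> succ G x"
      using z(1) z(2)[OF t(1)] t arc_succ[OF t(1)] succ_trans[of z G t w] by (auto simp: S_def)
    from ok_push[OF f t'(1)] obtain g where
      g: "ok g" "\<And>y. y \<notin> succ G x - {x} \<Longrightarrow> g y = f y" "f x \<le> g t'" by blast
    have "g t = f t" using g(2) n by blast
    then have "g t > 0" "g t' > 0" using g(3) t assms(2) by linarith+
    then show False using ok_positive_pred_unique[OF g(1) t(1) t'(2)] n t' by blast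
  qed
  then have "(x, z) \<in> arcs G" "f z > 0" "w \<in> succ G z" using t z(1) by (auto simp: S_def)
  then show ?thesis by (rule that)
qed


section \<open>The set of marked pairs\<close>

text \<open>The graph-level notion through which the concurrency of nodes and that of roots are
  compared.\<close>

definition conc :: "'v \<Rightarrow> 'v \<Rightarrow> bool" where
  "conc v w \<longleftrightarrow> (\<exists>f. ok f \<and> f v > 0 \<and> f w > 0)"

end

text \<open>Closed form of the recursion: the calls started from \<open>v\<close> are made exactly
  on \<open>succ G v\<close>. Pairs are listed as the loops visit them; \<open>sym_closure\<close>
  adds the mirrored entries.\<close>

definition propagate_pairs :: "'v tfg \<Rightarrow> 'v \<Rightarrow> ('v \<times> 'v) set" where
  "propagate_pairs G v = (\<Union>u \<in> succ G v. {u} \<times> succ G u) \<union>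
     (\<Union>u \<in> succ G v. \<Union>w \<in> {w. (u, w) \<in> Rarcs G}. (succ G u - succ G w) \<times> succ G w)"

lemma propagate_pairs_R:
  assumes "u \<in> succ G v" "(u, w) \<in> Rarcs G" "a \<in> succ G u" "a \<notin> succ G w" "b \<in> succ G w"
  shows "(a, b) \<in> propagate_pairs G v"
  unfolding propagate_pairs_def using assms by blast

definition matrix_pairs :: "'v tfg \<Rightarrow> ('v \<Rightarrow> 'v \<Rightarrow> bool) \<Rightarrow> ('v \<times> 'v) set" where
  "matrix_pairs G par = (\<Union>v \<in> {v \<in> roots G. par v v}. propagate_pairs G v) \<union>
     (\<Union>(v, w) \<in> {(v, w). v \<in> roots G \<and> w \<in> roots G \<and> v \<noteq> w \<and> par v w}. succ G v \<times> succ G w)"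

definition sym_closure :: "('v \<times> 'v) set \<Rightarrow> ('v \<times> 'v) set" where
  "sym_closure S = S \<union> S\<inverse>"

context safe_flow_dag
begin

section \<open>Soundness and completeness of the marked pairs\<close>

lemma conc_sym: "conc v w \<longleftrightarrow> conc w v"
  unfolding conc_def by blast

lemma root_push:
  assumes "conc r r" "u \<in> succ G r"
  obtains f where "ok f" "f u > 0"
proof -
  obtain f where f: "ok f" "f r > 0" using assms(1) by (auto simp: conc_def)
  from ok_push[OF f(1) assms(2)] obtain g where "ok g" "f r \<le> g u" by blast
  then show ?thesis using that[of g] f by simp
qed

text \<open>A push from \<open>a\<close> to \<open>b\<close> keeps the token at \<open>a\<close>.
  For an \<open>R\<close>-arc from \<open>u\<close> to \<open>w\<close>, a push from
  \<open>u\<close> to \<open>a\<close> still leaves \<open>w\<close> marked, as \<open>u\<close>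
  keeps its token; the push from \<open>w\<close> to \<open>b\<close> then spares
  \<open>a\<close>.\<close>

lemma propagate_pairs_sound:
  assumes "conc r r" "(a, b) \<in> propagate_pairs G r"
  shows "conc a b"
proof -
  have "a \<in> succ G r \<and> b \<in> succ G a \<or> (\<exists>u w. u \<in> succ G r \<and> (u, w) \<in> Rarcs G \<and>
      a \<in> succ G u \<and> a \<notin> succ G w \<and> b \<in> succ G w)"
    using assms(2) unfolding propagate_pairs_def by blast
  then consider (below) "a \<in> succ G r" "b \<in> succ G a"
    | (R) u w where "u \<in> succ G r" "(u, w) \<in> Rarcs G" "a \<in> succ G u" "a \<notin> succ G w" "b \<in> succ G w"
    by blast
  then show ?thesis
  proof cases
    case below
    from root_push[OF assms(1) below(1)] obtain f where f: "ok f" "f a > 0" .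
    from ok_push[OF f(1) below(2)] obtain g where
      g: "ok g" "\<And>y. y \<notin> succ G a - {a} \<Longrightarrow> g y = f y" "f a \<le> g b" by blast
    have "g a = f a" using g(2) by blast
    then have "g a > 0" "g b > 0" using f(2) g(3) by linarith+
    then show ?thesis using g(1) unfolding conc_def by blast
  next
    case R
    from root_push[OF assms(1) R(1)] obtain f where f: "ok f" "f u > 0" .
    from ok_push[OF f(1) R(3)] obtain g where
      g: "ok g" "\<And>y. y \<notin> succ G u - {u} \<Longrightarrow> g y = f y" "f u \<le> g a" by blast
    have "g w > 0" using flow_R_le[OF ok_flow[OF g(1)] R(2)] g(2)[of u] f by simp
    from ok_push[OF g(1) R(5)] obtain h where
      h: "ok h" "\<And>y. y \<notin> succ G w - {w} \<Longrightarrow> h y = g y" "g w \<le> h b" by blast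
    have "h a = g a" using h(2) R(4) by blast
    then have "h a > 0" "h b > 0" using h(3) g(3) f(2) \<open>g w > 0\<close> by linarith+
    then show ?thesis using h(1) unfolding conc_def by blast
  qed
qed

text \<open>Distinct roots are incomparable, so when both are marked their successor sets are
  disjoint and the two pushes are independent.\<close>

lemma root_pairs_sound:
  assumes "v \<in> roots G" "w \<in> roots G" "v \<noteq> w" "conc v w" "a \<in> succ G v" "b \<in> succ G w"
  shows "conc a b"
proof -
  obtain f where f: "ok f" "f v > 0" "f w > 0" using assms(4) by (auto simp: conc_def)
  have vw: "v \<notin> succ G w" "w \<notin> succ G v" using assms succ_root by metis+
  have n: "a \<notin> succ G w" using positive_incomparable_disjoint[OF f vw] assms by blast
  from ok_push[OF f(1) assms(5)] obtain g where
    g: "ok g" "\<And>y. y \<notin> succ G v - {v} \<Longrightarrow> g y = f y" "f v \<le> g a" by blast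
  from ok_push[OF g(1) assms(6)] obtain h where
    h: "ok h" "\<And>y. y \<notin> succ G w - {w} \<Longrightarrow> h y = g y" "g w \<le> h b" by blast
  have "h a = g a" "g w = f w" using h(2) g(2) n vw by blast+
  then have "h a > 0" "h b > 0" using h(3) g(3) f(2,3) by linarith+
  then show ?thesis using h(1) unfolding conc_def by blast
qed

lemma matrix_pairs_complete:
  assumes "conc v w" and vw: "v \<in> nodes G" "w \<in> nodes G"
  shows "(v, w) \<in> sym_closure (matrix_pairs G conc)"
proof -
  obtain f where f: "ok f" "f v > 0" "f w > 0" using assms(1) by (auto simp: conc_def)
  have pos: "conc x y" if "f x > 0" "f y > 0" for x y using that f(1) by (auto simp: conc_def)
  have up: "\<exists>r \<in> roots G. f r > 0 \<and> x \<in> succ G r" if "f x > 0" "x \<in> nodes G" for x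
    using flow_positive_root[OF ok_flow[OF f(1)] that] .
  have propagated: "p \<in> matrix_pairs G conc"
    if "r \<in> roots G" "f r > 0" "p \<in> propagate_pairs G r" for r p
    using that pos unfolding matrix_pairs_def by blast
  have below: "(x, y) \<in> matrix_pairs G conc" if "f x > 0" "x \<in> nodes G" "y \<in> succ G x" for x y
    using up[OF that(1,2)] that(3) propagated unfolding propagate_pairs_def by blast
  \<comment> \<open>Common marked ancestors of \<open>v\<close> and \<open>w\<close>. If there is
    none, the two tokens come from distinct roots.\<close>
  define S where "S = {u \<in> nodes G. f u > 0 \<and> v \<in> succ G u \<and> w \<in> succ G u}"
  consider (comparable) "v \<in> succ G w \<or> w \<in> succ G v" | (none) "S = {}"
    | (some) "v \<notin> succ G w" "w \<notin> succ G v" "S \<noteq> {}" by blast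
  then show ?thesis
  proof cases
    case comparable
    then show ?thesis using below f vw by (auto simp: sym_closure_def)
  next
    case none
    obtain r where r: "r \<in> roots G" "f r > 0" "v \<in> succ G r" using up f vw by blast
    obtain r' where r': "r' \<in> roots G" "f r' > 0" "w \<in> succ G r'" using up f vw by blast
    have "r \<noteq> r'" using none r r' by (auto simp: S_def roots_def)
    then have "(v, w) \<in> matrix_pairs G conc"
      using r r' pos[of r r'] unfolding matrix_pairs_def by blast
    then show ?thesis by (simp add: sym_closure_def)
  next
    case some
    \<comment> \<open>A lowest common marked ancestor: no arc-successor of \<open>u\<close> is in
      \<open>S\<close>.\<close>
    then obtain u where u: "u \<in> S" "\<And>y. (u, y) \<in> arcs G \<Longrightarrow> y \<notin> S"
      using wfE_min[OF wf_arcs_converse] by (metis converse_iff ex_in_conv)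
    have u': "u \<in> nodes G" "f u > 0" "v \<in> succ G u" "w \<in> succ G u" "v \<noteq> u" "w \<noteq> u"
      using u(1) some by (auto simp: S_def)
    from positive_step[OF f(1) u'(2) f(2) u'(3,5)] obtain x where
      x: "(u, x) \<in> arcs G" "f x > 0" "v \<in> succ G x" .
    from positive_step[OF f(1) u'(2) f(3) u'(4,6)] obtain y where
      y: "(u, y) \<in> arcs G" "f y > 0" "w \<in> succ G y" .
    \<comment> \<open>Otherwise \<open>x\<close> or \<open>y\<close>, both marked, would be in
      \<open>S\<close>.\<close>
    have n: "w \<notin> succ G x" "v \<notin> succ G y"
      using u(2)[OF x(1)] u(2)[OF y(1)] x y arcs_nodes by (auto simp: S_def)
    \<comment> \<open>By \<open>n\<close>, \<open>x\<close> and \<open>y\<close> differ, and two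
      distinct \<open>A\<close>-successors cannot both be marked.\<close>
    then have R: "(u, x) \<in> Rarcs G \<or> (u, y) \<in> Rarcs G"
      using ok_positive_A_succ_unique[OF f(1), of u x y] x y by (auto simp: arcs_def)
    obtain r where r: "r \<in> roots G" "f r > 0" "u \<in> succ G r" using up[OF u'(2,1)] by blast
    \<comment> \<open>An \<open>R\<close>-arc to \<open>x\<close> gives \<open>(w, v)\<close>, one
      to \<open>y\<close> gives \<open>(v, w)\<close>.\<close>
    have "(w, v) \<in> propagate_pairs G r \<or> (v, w) \<in> propagate_pairs G r"
      using R propagate_pairs_R[OF r(3) _ u'(4) n(1) x(3)] propagate_pairs_R[OF r(3) _ u'(3) n(2) y(3)]
      by blast
    then have "(w, v) \<in> matrix_pairs G conc \<or> (v, w) \<in> matrix_pairs G conc"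
      using propagated[OF r(1,2)] by blast
    then show ?thesis unfolding sym_closure_def by blast
  qed
qed

lemma matrix_pairs_correct:
  assumes "v \<in> nodes G" "w \<in> nodes G"
  shows "(v, w) \<in> sym_closure (matrix_pairs G (\<lambda>v w. v \<in> roots G \<and> w \<in> roots G \<and> conc v w)) \<longleftrightarrow>
    conc v w"
proof -
  have "matrix_pairs G (\<lambda>v w. v \<in> roots G \<and> w \<in> roots G \<and> conc v w) = matrix_pairs G conc"
    unfolding matrix_pairs_def by auto
  moreover have "conc a b" if "(a, b) \<in> matrix_pairs G conc" for a b
    using that propagate_pairs_sound root_pairs_sound unfolding matrix_pairs_def by blast
  ultimately show ?thesis
    using matrix_pairs_complete[OF _ assms] conc_sym[of v w] unfolding sym_closure_def by auto
qed

end


section \<open>Runs of the algorithm\<close>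

lemma enumerates_exists: "finite S \<Longrightarrow> \<exists>xs. enumerates xs S"
  unfolding enumerates_def by (meson finite_distinct_list)

text \<open>Each task spawns only tasks of a smaller kind, except that \<open>Propagate\<close>
  calls itself along arcs; the node in the second component handles that case.\<close>

fun task_rank :: "'v task \<Rightarrow> nat \<times> 'v" where
  "task_rank Matrix = (3, undefined)"
| "task_rank (Propagate v) = (2, v)"
| "task_rank (Mark S) = (1, undefined)"
| "task_rank (Mark1 x y) = (0, undefined)"

definition task_order :: "'v tfg \<Rightarrow> ('v task \<times> 'v task) set" where
  "task_order G = inv_image (less_than <*lex*> (arcs G)\<inverse>) task_rank"

text \<open>One task is replaced by finitely many smaller ones, so a single \<open>mult1\<close>
  step suffices once the stack order is forgotten.\<close>

lemma alg_step_mult1: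
  assumes "alg_step G par (ts, M) (ts', M')"
  shows "(mset ts', mset ts) \<in> mult1 (task_order G)"
proof -
  have *: "(mset (us @ ts'), mset (t # ts')) \<in> mult1 (task_order G)"
    if "\<forall>u \<in> set us. (u, t) \<in> task_order G" for us t and ts' :: "'a task list"
    using that by (intro mult1I[of _ t "mset ts'" _ "mset us"]) auto
  show ?thesis using assms
  proof cases
    case (matrix vs ps rest)
    have "\<forall>u \<in> set (map Propagate vs @ map (\<lambda>(v, w). Mark (succ G v \<times> succ G w)) ps).
        (u, Matrix) \<in> task_order G"
      by (auto simp: task_order_def)
    from *[OF this, of rest] show ?thesis unfolding matrix by simp
  next
    case (propagate ws v rs rest)
    have "\<forall>u \<in> set (Mark ({v} \<times> succ G v) # map Propagate ws @
        map (\<lambda>w. Mark ((succ G v - succ G w) \<times> succ G w)) rs). (u, Propagate v) \<in> task_order G"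
      using propagate by (auto simp: task_order_def enumerates_def)
    from *[OF this, of rest] show ?thesis unfolding propagate by simp
  next
    case (mark ps S rest)
    have "\<forall>u \<in> set (map (\<lambda>(x, y). Mark1 x y) ps). (u, Mark S) \<in> task_order G"
      by (auto simp: task_order_def)
    from *[OF this, of rest] show ?thesis unfolding mark by simp
  next
    case (mark1 x y)
    then show ?thesis using *[of "[]" "Mark1 x y" ts'] by simp
  qed
qed

section \<open>The invariant of a run and the final matrix\<close>

fun task_pairs :: "'v tfg \<Rightarrow> ('v \<Rightarrow> 'v \<Rightarrow> bool) \<Rightarrow> 'v task \<Rightarrow> ('v \<times> 'v) set" where
  "task_pairs G par Matrix = matrix_pairs G par"
| "task_pairs G par (Propagate v) = propagate_pairs G v"
| "task_pairs G par (Mark S) = S"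
| "task_pairs G par (Mark1 x y) = {(x, y)}"

text \<open>Marked pairs together with pairs still due form a constant set. \<open>Matrix\<close> is
  excluded since its step erases the matrix, so the invariant starts after the first step.
  Finiteness of the loop sets ensures progress, and the bound by 1 makes unmarked entries 0.\<close>

definition run_inv :: "'v tfg \<Rightarrow> ('v \<Rightarrow> 'v \<Rightarrow> bool) \<Rightarrow> 'v state \<Rightarrow> bool" where
  "run_inv G par = (\<lambda>(ts, M). Matrix \<notin> set ts \<and> (\<forall>S. Mark S \<in> set ts \<longrightarrow> finite S) \<and>
     (\<forall>x y. M x y \<le> 1) \<and>
     {(x, y). M x y = 1} \<union> sym_closure (\<Union>t \<in> set ts. task_pairs G par t) =
       sym_closure (matrix_pairs G par))"

lemma run_inv_replace:
  assumes "run_inv G par (t # ts, M)" "(\<Union>u \<in> set us. task_pairs G par u) = task_pairs G par t"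
    and "Matrix \<notin> set us" "\<And>S. Mark S \<in> set us \<Longrightarrow> finite S"
  shows "run_inv G par (us @ ts, M)"
proof -
  have "(\<Union>u \<in> set (us @ ts). task_pairs G par u) = (\<Union>u \<in> set (t # ts). task_pairs G par u)"
    using assms(2) by (simp add: UN_Un)
  then show ?thesis using assms(1,3,4) by (simp add: run_inv_def)
qed

lemma sym_closure_Un: "sym_closure (S \<union> T) = sym_closure S \<union> sym_closure T"
  by (auto simp: sym_closure_def)

lemma succ_unfold: "succ G v = insert v (\<Union>w \<in> {w. (v, w) \<in> arcs G}. succ G w)"
  unfolding succ_def by (auto elim: converse_rtranclE intro: converse_rtrancl_into_rtrancl)

text \<open>One unfolding of the closed form yields the three groups of tasks that a
  \<open>Propagate\<close> step puts on the stack.\<close>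

lemma propagate_pairs_unfold:
  "propagate_pairs G v = {v} \<times> succ G v \<union> (\<Union>w \<in> {w. (v, w) \<in> arcs G}. propagate_pairs G w) \<union>
     (\<Union>w \<in> {w. (v, w) \<in> Rarcs G}. (succ G v - succ G w) \<times> succ G w)"
proof -
  have *: "(\<Union>u \<in> succ G v. F u) = F v \<union> (\<Union>w \<in> {w. (v, w) \<in> arcs G}. \<Union>u \<in> succ G w. F u)"
    for F :: "_ \<Rightarrow> ('a \<times> 'a) set"
    by (subst succ_unfold) blast
  show ?thesis
    unfolding propagate_pairs_def
    by (subst (1 2) *) blast
qed

context flow_dag
begin

text \<open>The multiset order is well-founded because a finite acyclic graph has no infinite
  path.\<close>

lemma no_infinite_run: "\<not> (\<forall>i. alg_step G par (s i) (s (Suc i)))"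
proof
  assume run: "\<forall>i. alg_step G par (s i) (s (Suc i))"
  have "wf (mult1 (task_order G))"
    unfolding task_order_def
    by (intro wf_mult1 wf_inv_image wf_lex_prod wf_less_than wf_arcs_converse)
  moreover have "(mset (fst (s (Suc i))), mset (fst (s i))) \<in> mult1 (task_order G)" for i
    using run alg_step_mult1[of G par "fst (s i)" "snd (s i)" "fst (s (Suc i))" "snd (s (Suc i))"]
    by simp
  ultimately show False
    unfolding wf_iff_no_infinite_down_chain by (auto dest: spec[of _ "\<lambda>i. mset (fst (s i))"])
qed

text \<open>A step could fail only for lack of an enumeration, and every set to be enumerated is
  finite.\<close>

lemma alg_step_progress:
  assumes "\<forall>S. Mark S \<in> set (t # ts) \<longrightarrow> finite S"
  shows "\<exists>s'. alg_step G par (t # ts, M) s'"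
proof (cases t)
  case Matrix
  have fin: "finite (roots G)" using finite_nodes by (simp add: roots_def)
  then have "finite {v \<in> roots G. par v v}" by simp
  from enumerates_exists[OF this] obtain vs where vs: "enumerates vs {v \<in> roots G. par v v}" ..
  have "finite {(v, w). v \<in> roots G \<and> w \<in> roots G \<and> v \<noteq> w \<and> par v w}"
    by (rule finite_subset[of _ "roots G \<times> roots G"]) (use fin in auto)
  from enumerates_exists[OF this] obtain ps where
    ps: "enumerates ps {(v, w). v \<in> roots G \<and> w \<in> roots G \<and> v \<noteq> w \<and> par v w}" ..
  show ?thesis unfolding Matrix by (rule exI, rule alg_step.matrix[OF vs ps])
next
  case (Propagate v)
  have "finite {w. (v, w) \<in> arcs G}"
    by (rule finite_subset[OF _ finite_nodes]) (use arcs_nodes in auto)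
  from enumerates_exists[OF this] obtain ws where ws: "enumerates ws {w. (v, w) \<in> arcs G}" ..
  have "finite {w. (v, w) \<in> Rarcs G}"
    by (rule finite_subset[OF _ finite_nodes]) (use arcs_nodes in \<open>auto simp: arcs_def\<close>)
  from enumerates_exists[OF this] obtain rs where rs: "enumerates rs {w. (v, w) \<in> Rarcs G}" ..
  show ?thesis unfolding Propagate by (rule exI, rule alg_step.propagate[OF ws rs])
next
  case (Mark S)
  then have "finite S" using assms by simp
  from enumerates_exists[OF this] obtain ps where ps: "enumerates ps S" ..
  show ?thesis unfolding Mark by (rule exI, rule alg_step.mark[OF ps])
next
  case (Mark1 x y)
  show ?thesis unfolding Mark1 by (rule exI, rule alg_step.mark1)
qed

lemma run_inv_start:
  assumes "alg_step G par ([Matrix], M0) s"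
  shows "run_inv G par s"
  using assms
proof cases
  case (matrix vs ps)
  then have "(\<Union>t \<in> set (fst s). task_pairs G par t) = matrix_pairs G par"
    unfolding matrix_pairs_def by (auto simp: enumerates_def)
  then show ?thesis using matrix finite_succ by (auto simp: run_inv_def)
qed

lemma run_inv_step:
  assumes "alg_step G par s s'" "run_inv G par s"
  shows "run_inv G par s'"
  using assms(1)
proof cases
  case (matrix vs ps ts M)
  then show ?thesis using assms(2) by (simp add: run_inv_def)
next
  case (propagate ws v rs ts M)
  have "run_inv G par ((Mark ({v} \<times> succ G v) # map Propagate ws @
      map (\<lambda>w. Mark ((succ G v - succ G w) \<times> succ G w)) rs) @ ts, M)"
  proof (rule run_inv_replace)
    show "run_inv G par (Propagate v # ts, M)" using assms(2) propagate(1) by simp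
    show "(\<Union>u \<in> set (Mark ({v} \<times> succ G v) # map Propagate ws @
        map (\<lambda>w. Mark ((succ G v - succ G w) \<times> succ G w)) rs). task_pairs G par u) =
        task_pairs G par (Propagate v)"
      using propagate(3,4) by (simp add: enumerates_def propagate_pairs_unfold[of G v] UN_Un Un_assoc)
  qed (auto simp: finite_succ)
  then show ?thesis using propagate(2) by simp
next
  case (mark ps S ts M)
  have "run_inv G par (map (\<lambda>(x, y). Mark1 x y) ps @ ts, M)"
  proof (rule run_inv_replace)
    show "run_inv G par (Mark S # ts, M)" using assms(2) mark(1) by simp
    show "(\<Union>u \<in> set (map (\<lambda>(x, y). Mark1 x y) ps). task_pairs G par u) = task_pairs G par (Mark S)"
      using mark(3) by (force simp: enumerates_def)
  qed auto
  then show ?thesis using mark(2) by simp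
next
  case (mark1 x y ts M)
  have "{(a, b). mark_sym x y M a b = 1} = {(a, b). M a b = 1} \<union> sym_closure {(x, y)}"
    by (auto simp: mark_sym_def sym_closure_def)
  then have "{(a, b). mark_sym x y M a b = 1} \<union> sym_closure (\<Union>t \<in> set ts. task_pairs G par t) =
     {(a, b). M a b = 1} \<union> sym_closure (\<Union>t \<in> set (Mark1 x y # ts). task_pairs G par t)"
    by (simp add: sym_closure_Un Un_assoc sym_closure_def) blast
  then show ?thesis using mark1 assms(2) by (auto simp: run_inv_def mark_sym_def)
qed

lemma run_inv_reachable:
  assumes "(alg_step G par)\<^sup>*\<^sup>* ([Matrix], M0) s"
  shows "s = ([Matrix], M0) \<or> run_inv G par s"
  using assms by (induction rule: rtranclp_induct) (auto intro: run_inv_start run_inv_step)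

lemma alg_terminates: "alg_terminates G par M0"
  unfolding alg_terminates_def
proof (intro conjI allI impI)
  show "\<nexists>s. s 0 = ([Matrix], M0) \<and> (\<forall>i. alg_step G par (s i) (s (Suc i)))"
    using no_infinite_run by blast
  fix ts M
  assume run: "(alg_step G par)\<^sup>*\<^sup>* ([Matrix], M0) (ts, M)" and stuck: "\<nexists>s'. alg_step G par (ts, M) s'"
  \<comment> \<open>The initial stack contains no \<open>Mark\<close> task, and every later state
    satisfies the invariant.\<close>
  have "\<forall>S. Mark S \<in> set ts \<longrightarrow> finite S"
    using run_inv_reachable[OF run] by (auto simp: run_inv_def)
  then show "ts = []" using alg_step_progress stuck by (cases ts) auto
qed

lemma alg_returns_value:
  assumes "alg_returns G par M0 M"
  shows "M x y = (if (x, y) \<in> sym_closure (matrix_pairs G par) then 1 else 0)"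
proof -
  have "run_inv G par ([], M)"
    using assms run_inv_reachable unfolding alg_returns_def by fastforce
  then have "M x y \<le> 1" "{(x, y). M x y = 1} = sym_closure (matrix_pairs G par)"
    by (auto simp: run_inv_def sym_closure_def)
  then show ?thesis by (metis (mono_tags, lifting) case_prodI le_less less_one mem_Collect_eq case_prodD)
qed

end


section \<open>Flows of an equivalence\<close>

lemma solution_equation:
  "solution K F f \<Longrightarrow> (x, Y) \<in> F \<Longrightarrow> f x = (\<Sum>y\<in>#Y. summand_value f y)"
  unfolding solution_def by blast

locale tfg_equivalence =
  fixes K :: "nat \<Rightarrow> 'v set"
    and E :: "'v equation set"
    and N1 :: "('v, 't1) net" and m1 :: "'v \<rightharpoonup> nat"
    and N2 :: "('v, 't2) net" and m2 :: "'v \<rightharpoonup> nat"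
    and G :: "'v tfg"
  assumes constant_sets: "constant_sets K"
    and finite_E: "finite E"
    and petri_nets: "petri_net N1" "petri_net N2"
    and marking_m2: "marking N2 m2"
    and equivalent: "E_equivalent K E N1 m1 N2 m2"
    and safe: "safe N1 m1"
    and well_formed: "well_formed_tfg K E N1 N2 G"
begin

section \<open>Consequences of well-formedness, and solutions as flows\<close>

lemma constants_unique: "x \<in> K i \<Longrightarrow> x \<in> K j \<Longrightarrow> i = j"
  using constant_sets unfolding constant_sets_def by blast

lemma is_tfg: "is_tfg K (nodes G - constants K) G"
  using well_formed unfolding well_formed_tfg_def by blast

lemma nodes_eq: "nodes G - constants K = places N1 \<union> places N2 \<union> fv K E"
  using well_formed by (simp add: well_formed_tfg_def)

lemma places_nodes: "places N1 \<subseteq> nodes G" "places N2 \<subseteq> nodes G"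
  using nodes_eq by blast+

lemma constant_roots: "v \<in> nodes G \<Longrightarrow> v \<in> K n \<Longrightarrow> v \<in> roots G"
  using well_formed by (auto simp: well_formed_tfg_def constants_def)

lemma roots_eq: "roots G - constants K = places N2"
  using well_formed by (simp add: well_formed_tfg_def)

lemma Aleaves_eq: "Aleaves G - constants K = places N1"
  using well_formed by (simp add: well_formed_tfg_def)

lemma E_iff: "(v, Y) \<in> E \<longleftrightarrow>
    (\<exists>X. Y = image_mset Name (mset_set X) \<and> (A_succs G v X \<or> R_preds G X v))"
  using well_formed by (simp add: well_formed_tfg_def)

lemma finite_fv: "finite (fv K E)"
proof -
  have "fv K E \<subseteq> fst ` E \<union> (\<Union>(y, Y) \<in> E. {x. Name x \<in># Y})"
    by (force simp: fv_def)
  moreover have "finite {x. Name x \<in># Y}" for Y :: "'v summand multiset"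
    by (rule finite_surj[of "set_mset Y" _ "\<lambda>s. case s of Name x \<Rightarrow> x"]) (auto intro!: image_eqI)
  ultimately show ?thesis
    using finite_E by (elim finite_subset) auto
qed

sublocale flow_dag G
proof
  show "acyclic (arcs G)"
    using well_formed unfolding well_formed_tfg_def by (elim conjE)
  have "\<forall>p p' q. (p, q) \<in> Aarcs G \<longrightarrow> (p', q) \<in> arcs G \<longrightarrow> p = p'"
    using well_formed unfolding well_formed_tfg_def by (elim conjE)
  then show "p = p'" if "(p, q) \<in> Aarcs G" "(p', q) \<in> arcs G" for p q p' using that by blast
  obtain S where "finite S" "nodes G = (nodes G - constants K) \<union> S"
    using is_tfg by (auto simp: is_tfg_def)
  moreover have "finite (nodes G - constants K)"
    using nodes_eq petri_nets finite_fv by (simp add: petri_net_def)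
  ultimately show "finite (nodes G)" by (metis finite_UnI)
  show "arcs G \<subseteq> nodes G \<times> nodes G" "Rarcs G \<inter> Aarcs G = {}"
    using is_tfg by (auto simp: is_tfg_def arcs_def)
qed

lemma equation_nodes:
  assumes "A_succs G v X \<or> R_preds G X v"
  shows "v \<in> nodes G" "X \<subseteq> nodes G" "finite X"
proof -
  show "v \<in> nodes G" "X \<subseteq> nodes G"
    using assms arcs_nodes by (auto simp: A_succs_def R_preds_def arcs_def)
  then show "finite X" using finite_nodes finite_subset by blast
qed

lemma summand_value_sum:
  "(\<Sum>y \<in># image_mset Name (mset_set X). summand_value f y) = (\<Sum>x\<in>X. f x)"
  by (simp add: sum_unfold_sum_mset multiset.map_comp comp_def)

lemma solution_flow:
  assumes "solution K (E \<union> F) f"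
  shows "flow G f"
  unfolding flow_def
proof (intro allI impI)
  fix v X
  assume "A_succs G v X \<or> R_preds G X v"
  then have "(v, image_mset Name (mset_set X)) \<in> E \<union> F" using E_iff by blast
  from solution_equation[OF assms this] show "f v = sum f X" using summand_value_sum[of f X] by simp
qed

definition restr :: "('v \<Rightarrow> nat) \<Rightarrow> 'v set \<Rightarrow> ('v \<rightharpoonup> nat)" where
  "restr f P = (\<lambda>x. if x \<in> P then Some (f x) else None)"

text \<open>Total-function form of the configurations that define the concurrency relation of the
  graph.\<close>

definition reachable_flow :: "('v \<Rightarrow> nat) \<Rightarrow> bool" where
  "reachable_flow f \<longleftrightarrow> flow G f \<and> (\<forall>n. \<forall>v \<in> nodes G \<inter> K n. f v = n) \<and>
     restr f (places N2) \<in> reachable N2 m2"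

lemma reachable_marking: "m \<in> reachable N2 m2 \<Longrightarrow> marking N2 m"
  by (induction rule: reachable.induct)
    (use marking_m2 in \<open>auto simp: marking_def fire_def split: if_splits\<close>)

text \<open>Every equation of \<open>E\<close> comes from the graph by (T4), so a flow solves it;
  the two map systems only record its values on places.\<close>

lemma flow_solution:
  assumes flow: "flow G f" and const: "\<And>n v. v \<in> nodes G \<Longrightarrow> v \<in> K n \<Longrightarrow> f v = n"
  shows "consistent K (E \<union> map_system (restr f (places N1)) \<union> map_system (restr f (places N2)))"
proof -
  \<comment> \<open>A solution must give every constant its value, including constants that are not
    nodes. Other names off the graph get an arbitrary value; no equation mentions them.\<close>
  define g where "g x = (if x \<in> nodes G then f x else THE n. x \<in> K n)" for x
  have "g k = n" if "k \<in> K n" for k n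
  proof -
    have "(THE n. k \<in> K n) = n" using that constants_unique by blast
    then show ?thesis using const that by (simp add: g_def)
  qed
  moreover have "g x = (\<Sum>y\<in>#Y. summand_value g y)" if xY: "(x, Y) \<in> E" for x Y
  proof -
    obtain X where X: "Y = image_mset Name (mset_set X)" "A_succs G x X \<or> R_preds G X x"
      using iffD1[OF E_iff xY] by blast
    have "f x = sum f X" using flow X(2) by (auto simp: flow_def)
    moreover have "sum g X = sum f X"
      using equation_nodes[OF X(2)] by (intro sum.cong) (auto simp: g_def)
    ultimately show ?thesis
      using X(1) equation_nodes[OF X(2)] by (simp add: summand_value_sum g_def del: image_mset_mset_set)
  qed
  moreover have "g x = (\<Sum>y\<in>#Y. summand_value g y)"
    if "(x, Y) \<in> map_system (restr f P)" "P \<subseteq> nodes G" for x Y P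
    using that by (auto simp: map_system_def restr_def g_def split: if_splits)
  ultimately have "solution K (E \<union> map_system (restr f (places N1)) \<union> map_system (restr f (places N2))) g"
    using places_nodes unfolding solution_def by blast
  then show ?thesis by (auto simp: consistent_def)
qed

text \<open>(A3) transfers reachability between the two restrictions of one flow; this is how safety
  of \<open>N1\<close> reaches the graph.\<close>

lemma reachable_flow_N1:
  assumes "reachable_flow f"
  shows "restr f (places N1) \<in> reachable N1 m1"
proof -
  have "consistent K (E \<union> map_system (restr f (places N1)) \<union> map_system (restr f (places N2)))"
    using assms by (intro flow_solution) (auto simp: reachable_flow_def)
  moreover have "marking N1 (restr f (places N1))" "marking N2 (restr f (places N2))"
    by (auto simp: marking_def restr_def split: if_splits)
  ultimately show ?thesis
    using equivalent assms unfolding E_equivalent_def reachable_flow_def by blast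
qed

sublocale safe_flow_dag G reachable_flow
proof
  fix f v
  assume f: "reachable_flow f" and v: "v \<in> Aleaves G" "v \<notin> roots G"
  have "v \<in> nodes G" using v by (simp add: Aleaves_def)
  \<comment> \<open>By (T2) a non-root node is no constant, so this \<open>A\<close>-leaf is a place
    of \<open>N1\<close>.\<close>
  then have "v \<in> places N1" using v constant_roots Aleaves_eq by (auto simp: constants_def)
  then show "f v \<le> 1"
    using reachable_flow_N1[OF f] safe unfolding safe_def by (fastforce simp: restr_def)
next
  fix f g
  assume f: "reachable_flow f" and g: "flow G g" "\<And>r. r \<in> roots G \<Longrightarrow> g r = f r"
  \<comment> \<open>Places of \<open>N2\<close> are roots, so the restriction depends only on root
    values.\<close>
  have "restr g (places N2) = restr f (places N2)"
    using g(2) roots_eq by (auto simp: restr_def fun_eq_iff)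
  then show "reachable_flow g"
    using f g constant_roots by (auto simp: reachable_flow_def)
qed (simp add: reachable_flow_def)

text \<open>(A1) gives a solution of \<open>E\<close> that agrees with \<open>m\<close> on the
  places of \<open>N2\<close>, and each solution is a flow.\<close>

lemma reachable_flow_exists:
  assumes "m \<in> reachable N2 m2"
  obtains f where "reachable_flow f" "\<And>p. p \<in> places N2 \<Longrightarrow> f p = the (m p)"
proof -
  obtain f where f: "solution K (E \<union> map_system m) f"
    using equivalent assms unfolding E_equivalent_def consistent_def by blast
  have dom: "dom m = places N2" using reachable_marking[OF assms] by (simp add: marking_def)
  have val: "f p = n" if "m p = Some n" for p n
  proof -
    have "(p, {#Number n#}) \<in> E \<union> map_system m" using that by (auto simp: map_system_def)
    from solution_equation[OF f this] show ?thesis by simp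
  qed
  have "restr f (places N2) x = m x" for x
    using val[of x] dom by (cases "m x") (auto simp: restr_def)
  then have "restr f (places N2) = m" by blast
  then have "reachable_flow f"
    using f solution_flow[OF f] assms by (auto simp: reachable_flow_def solution_def)
  moreover have "f p = the (m p)" if "p \<in> places N2" for p
    using that val dom by force
  ultimately show ?thesis by (rule that)
qed

lemma reachable_flow_const: "reachable_flow f \<Longrightarrow> v \<in> roots G \<Longrightarrow> v \<in> K n \<Longrightarrow> f v = n"
  unfolding reachable_flow_def roots_def by blast

section \<open>Concurrency of places, of roots and of nodes\<close>

lemma concurrent_conc:
  assumes "concurrent N2 m2 v w"
  shows "conc v w"
proof -
  obtain m where m: "m \<in> reachable N2 m2" "the (m v) > 0" "the (m w) > 0"
    using assms by (auto simp: concurrent_def)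
  from reachable_flow_exists[OF m(1)] obtain f where
    f: "reachable_flow f" "\<And>p. p \<in> places N2 \<Longrightarrow> f p = the (m p)" by blast
  have "f v = the (m v)" "f w = the (m w)" using assms f(2) by (auto simp: concurrent_def)
  then show ?thesis using f(1) m(2,3) by (auto simp: conc_def)
qed

lemma conc_concurrent:
  assumes "conc v w" "v \<in> places N2" "w \<in> places N2"
  shows "concurrent N2 m2 v w"
proof -
  obtain f where "reachable_flow f" "f v > 0" "f w > 0" using assms(1) by (auto simp: conc_def)
  then have "restr f (places N2) \<in> reachable N2 m2" "the (restr f (places N2) v) > 0"
    "the (restr f (places N2) w) > 0"
    using assms(2,3) by (auto simp: reachable_flow_def restr_def)
  then show ?thesis using assms(2,3) unfolding concurrent_def by blast
qed

lemma live_root_iff: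
  assumes "v \<in> roots G"
  shows "live_root K N2 m2 v \<longleftrightarrow> conc v v"
proof
  assume "live_root K N2 m2 v"
  then consider (const) n where "n \<ge> 1" "v \<in> K n" | (place) "concurrent N2 m2 v v"
    unfolding live_root_def nondead_def by blast
  then show "conc v v"
  proof cases
    case const
    \<comment> \<open>Some reachable flow exists, over the initial marking; it gives the constant
      its value \<open>n\<close>.\<close>
    obtain f where "reachable_flow f" using reachable_flow_exists[OF reachable.refl] by blast
    then show ?thesis using reachable_flow_const[OF _ assms const(2)] const(1)
      unfolding conc_def by force
  qed (rule concurrent_conc)
next
  assume c: "conc v v"
  then obtain f where f: "reachable_flow f" "f v > 0" by (auto simp: conc_def)
  show "live_root K N2 m2 v"
  proof (cases "v \<in> constants K")
    case True
    then obtain n where n: "v \<in> K n" by (auto simp: constants_def)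
    then have "n \<ge> 1" using reachable_flow_const[OF f(1) assms n] f(2) by simp
    then show ?thesis using n unfolding live_root_def by blast
  next
    case False
    then show ?thesis using c assms roots_eq conc_concurrent
      unfolding live_root_def nondead_def by blast
  qed
qed

text \<open>A positive constant root is marked in every reachable flow, so only \<open>w\<close>
  matters.\<close>

lemma conc_constant_root:
  assumes "v \<in> roots G" "v \<in> K n" "n \<ge> 1"
  shows "conc v w \<longleftrightarrow> conc w w"
  using reachable_flow_const[OF _ assms(1,2)] assms(3) unfolding conc_def by force

lemma root_concurrent_iff:
  "root_concurrent K G N2 m2 v w \<longleftrightarrow> v \<in> roots G \<and> w \<in> roots G \<and> conc v w"
proof (cases "v \<in> roots G \<and> w \<in> roots G")
  case roots: True
  \<comment> \<open>A root that is no place of \<open>N2\<close> is a constant, and being marked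
    makes its value positive.\<close>
  have const: "\<exists>n\<ge>1. x \<in> K n" if c: "conc x y" and x: "x \<in> roots G" "x \<notin> places N2" for x y
  proof -
    obtain n where n: "x \<in> K n" using x roots_eq by (auto simp: constants_def)
    obtain f where f: "reachable_flow f" "f x > 0" using c by (auto simp: conc_def)
    show ?thesis using reachable_flow_const[OF f(1) x(1) n] f(2) n by (intro exI[of _ n]) simp
  qed
  have "conc v w" if "concurrent N2 m2 v w \<or> (\<exists>n\<ge>1. v \<in> K n) \<and> conc w w \<or>
      (\<exists>n\<ge>1. w \<in> K n) \<and> conc v v"
    using that concurrent_conc conc_constant_root[of v _ w] conc_constant_root[of w _ v]
      conc_sym[of v w] roots by blast
  moreover have "concurrent N2 m2 v w \<or> (\<exists>n\<ge>1. v \<in> K n) \<and> conc w w \<or>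
      (\<exists>n\<ge>1. w \<in> K n) \<and> conc v v" if c: "conc v w"
  proof -
    have "conc v v" "conc w w" using c by (auto simp: conc_def)
    then show ?thesis
      using const[OF c] const[of w v] conc_concurrent[OF c] c conc_sym[of v w] roots by blast
  qed
  ultimately show ?thesis
    using roots live_root_iff[of v] live_root_iff[of w] unfolding root_concurrent_def by blast
qed (auto simp: root_concurrent_def)

lemma tfg_concurrent_iff:
  assumes vw: "v \<in> nodes G" "w \<in> nodes G"
  shows "tfg_concurrent K G N2 m2 v w \<longleftrightarrow> conc v w"
proof
  assume "tfg_concurrent K G N2 m2 v w"
  then obtain c where c: "configuration K G c" "dom c = nodes G" "well_defined G c"
      "c |` places N2 \<in> reachable N2 m2" "the (c v) > 0" "the (c w) > 0"
    unfolding tfg_concurrent_def total_configuration_def by blast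
  define f where "f x = the (c x)" for x
  have "flow G f"
    unfolding flow_def
  proof (intro allI impI)
    fix x X
    assume X: "A_succs G x X \<or> R_preds G X x"
    then have "c x \<noteq> None" using equation_nodes(1) c(2) by blast
    then show "f x = sum f X" using c(3) X unfolding well_defined_def f_def by blast
  qed
  moreover have "restr f (places N2) = c |` places N2"
    using c(2) places_nodes by (force simp: restr_def restrict_map_def f_def)
  moreover have "f x = n" if "x \<in> nodes G" "x \<in> K n" for x n
    using c(1) that unfolding configuration_def f_def by force
  ultimately have "reachable_flow f" using c(4) by (simp add: reachable_flow_def)
  then show "conc v w" using c(5,6) unfolding conc_def f_def by blast
next
  assume "conc v w"
  then obtain f where f: "reachable_flow f" "f v > 0" "f w > 0" by (auto simp: conc_def)
  define c where "c = restr f (nodes G)"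
  have "configuration K G c" "total_configuration G c"
    using f(1) by (auto simp: c_def restr_def configuration_def total_configuration_def
        reachable_flow_def split: if_splits)
  moreover have "well_defined G c"
    unfolding well_defined_def
  proof (intro conjI allI impI)
    show "\<forall>(x, y) \<in> arcs G. c x = None \<longleftrightarrow> c y = None"
      using arcs_nodes by (auto simp: c_def restr_def)
    fix x X
    assume X: "A_succs G x X \<or> R_preds G X x"
    have "f x = sum f X" using f(1) X by (auto simp: reachable_flow_def flow_def)
    also have "\<dots> = (\<Sum>y\<in>X. the (c y))"
      using equation_nodes(2)[OF X] by (intro sum.cong) (auto simp: c_def restr_def)
    finally show "the (c x) = (\<Sum>y\<in>X. the (c y))"
      using equation_nodes(1)[OF X] by (simp add: c_def restr_def)
  qed
  moreover have "c |` places N2 = restr f (places N2)"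
    using places_nodes by (auto simp: c_def restr_def restrict_map_def fun_eq_iff)
  ultimately show "tfg_concurrent K G N2 m2 v w"
    using f vw unfolding tfg_concurrent_def reachable_flow_def
    by (intro conjI exI[of _ c]) (auto simp: c_def restr_def)
qed

lemma matrix_correct:
  assumes "alg_returns G (root_concurrent K G N2 m2) M0 M" "v \<in> nodes G" "w \<in> nodes G"
  shows "M v w = (if tfg_concurrent K G N2 m2 v w then 1 else 0)"
proof -
  have "root_concurrent K G N2 m2 = (\<lambda>v w. v \<in> roots G \<and> w \<in> roots G \<and> conc v w)"
    using root_concurrent_iff by blast
  then show ?thesis
    using alg_returns_value[OF assms(1)] matrix_pairs_correct[OF assms(2,3)]
      tfg_concurrent_iff[OF assms(2,3)] by simp
qed

end

theorem theorem4:
  fixes K :: "nat \<Rightarrow> 'v set"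
    and E :: "'v equation set"
    and N1 :: "('v, 't1) net" and m1 :: "'v \<rightharpoonup> nat"
    and N2 :: "('v, 't2) net" and m2 :: "'v \<rightharpoonup> nat"
    and G :: "'v tfg"
    and M0 :: "'v \<Rightarrow> 'v \<Rightarrow> nat"
  assumes "constant_sets K"
    and "finite E"
    and "petri_net N1" and "marking N1 m1"
    and "petri_net N2" and "marking N2 m2"
    and "E_equivalent K E N1 m1 N2 m2"
    and "safe N1 m1" and "safe N2 m2"
    and "well_formed_tfg K E N1 N2 G"
  shows "alg_terminates G (root_concurrent K G N2 m2) M0 \<and>
    (\<forall>M. alg_returns G (root_concurrent K G N2 m2) M0 M \<longrightarrow>
       (\<forall>v\<in>nodes G. \<forall>w\<in>nodes G. M v w = M w v) \<and>
       (\<forall>v\<in>nodes G. \<forall>w\<in>nodes G. tfg_concurrent K G N2 m2 v w \<longleftrightarrow> M v w = 1))"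
proof -
  interpret tfg_equivalence K E N1 m1 N2 m2 G
    by unfold_locales fact+
  show ?thesis
  proof (intro conjI allI impI ballI alg_terminates)
    fix M v w
    assume M: "alg_returns G (root_concurrent K G N2 m2) M0 M" and vw: "v \<in> nodes G" "w \<in> nodes G"
    show "M v w = M w v"
      using matrix_correct[OF M vw] matrix_correct[OF M vw(2,1)] tfg_concurrent_iff[OF vw]
        tfg_concurrent_iff[OF vw(2,1)] conc_sym[of v w] by simp
    show "tfg_concurrent K G N2 m2 v w \<longleftrightarrow> M v w = 1"
      using matrix_correct[OF M vw] by simp
  qed
qed

end
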